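(* Let $z_1,z_2\in{\rm Im}\,\mathbb{H}$ and let $\Gamma=\{X_{(1,0,0)},X_{(1+z_1,0,0)},X_{(1+z_2,0,0)}\}$ be the corresponding family of vector fields on the sphere $S^3$. Suppose that the attractors $p_1$ and $p_2$ of $X_{(1+z_1,0,0)}$ and $X_{(1+z_2,0,0)}$ do not belong to the same great circle containing $\mathbf{1}$. Then the invariant control set for $\Gamma$ in $S^3$ is the spherical closed convex hull of $A=\{\mathbf{1},p_1,p_2\}$.
   Context: $\mathbb{H}$ denotes the quaternions, ${\rm Im}\,\mathbb{H}$ the purely imaginary quaternions, $\mathbf{1}$ the real quaternion $1$, and $S^3\subset\mathbb{H}$ the unit quaternions. For $q\in\mathbb{H}$, $X_{(q,0,0)}$ is the vector field on $S^3$ given by $X_{(q,0,0)}(p)=\frac12(q-p\overline{q}p)=q-\langle q,p\rangle p$. For $q\ne0$ its only singularities are $\pm q/|q|$, and its attractor is the point $q/|q|$ (which attracts every point except the antipode $-q/|q|$); thus $p_i=\frac{1+z_i}{|1+z_i|}$. The spherical closed convex hull of $A\subset S^3$ is $S^3\cap\mathrm{cl}({\rm co}A)$, where ${\rm co}A=\{\sum_{i=1}^n a_ip_i \mid a_i\ge0,\ p_i\in A,\ n\in\mathbb{N}\}$ is the conic hull of $A$. A trajectory of a family $\Gamma$ of vector fields is a continuous curve $\gamma:[0,T]\to S^3$, $T\ge0$, for which there is a finite partition of $[0,T]$ such that on each subinterval $\gamma$ is a (forward-time) integral curve of some element of $\Gamma$. The positive orbit $\mathcal{O}^+(x)$ is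 the set of endpoints of trajectories of $\Gamma$ starting at $x$. A nonempty set $C\subset S^3$ is an invariant control set of $\Gamma$ if (i) for every $x\in C$ there is a trajectory of $\Gamma$, defined for all $t\ge0$ (a concatenation of forward integral curves of elements of $\Gamma$), starting at $x$ and contained in $C$ for all $t\ge 0$; (ii) $\mathrm{cl}\,C=\mathrm{cl}\,\mathcal{O}^{+}(x)$ for every $x\in C$; (iii) $C$ is maximal with these properties: if $C'\supset C$ satisfies (i) and (ii) then $C'=C$. *)

theory Defs
  imports "HOL-Analysis.Analysis"
begin

text \<open>A quaternion is a pair of its real part and its imaginary part. The sum, real scaling, inner
  product, norm and topology are those of the product type, i.e. the Euclidean ones of $R^4$, so
  that the unit quaternions $S^3$ are \<open>sphere 0 1\<close>.\<close>

type_synonym quat = "real \<times> (real ^ 3)"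

definition qone :: quat where
  "qone = (1, 0)"

definition qconj :: "quat \<Rightarrow> quat" where
  "qconj q = (fst q, - snd q)"

definition qmult :: "quat \<Rightarrow> quat \<Rightarrow> quat" (infixl "\<cdot>\<^sub>q" 70) where
  "p \<cdot>\<^sub>q q =
    (fst p * fst q - inner (snd p) (snd q),
     fst p *\<^sub>R snd q + fst q *\<^sub>R snd p + cross3 (snd p) (snd q))"

definition ImH :: "quat set" where
  "ImH = {q. fst q = 0}"

abbreviation S3 :: "quat set" where
  "S3 \<equiv> sphere 0 1"

text \<open>The field $X_{(q,0,0)}$. Only its values on the sphere matter.\<close>

definition vfield :: "quat \<Rightarrow> quat \<Rightarrow> quat" where
  "vfield q p = (1/2) *\<^sub>R (q - p \<cdot>\<^sub>q qconj q \<cdot>\<^sub>q p)"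

lemma qmult_conj_self: "p \<cdot>\<^sub>q qconj p = (norm p)\<^sup>2 *\<^sub>R qone"
  by (simp add: qmult_def qconj_def qone_def power2_norm_eq_inner inner_prod_def cross3_def
      prod_eq_iff vec_eq_iff forall_3 inner_vec_def sum_3 algebra_simps)

lemma qmult_assoc: "(p \<cdot>\<^sub>q q) \<cdot>\<^sub>q r = p \<cdot>\<^sub>q (q \<cdot>\<^sub>q r)"
  by (simp add: qmult_def cross3_def prod_eq_iff vec_eq_iff forall_3 inner_vec_def sum_3
      algebra_simps)

lemma qmult_conj_mid:
  "p \<cdot>\<^sub>q qconj q \<cdot>\<^sub>q p = (2 * inner q p) *\<^sub>R p - (norm p)\<^sup>2 *\<^sub>R q"
  by (simp add: qmult_def qconj_def power2_norm_eq_inner inner_prod_def cross3_def prod_eq_iff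
      vec_eq_iff forall_3 inner_vec_def sum_3 algebra_simps)

lemma vfield_on_S3:
  assumes "p \<in> S3"
  shows "vfield q p = q - inner q p *\<^sub>R p"
  using assms by (simp add: vfield_def qmult_conj_mid scaleR_diff_right flip: scaleR_2)

definition integral_curve :: "(quat \<Rightarrow> quat) \<Rightarrow> (real \<Rightarrow> quat) \<Rightarrow> real set \<Rightarrow> bool" where
  "integral_curve X \<gamma> I \<longleftrightarrow>
     (\<forall>t\<in>I. \<gamma> t \<in> S3 \<and> (\<gamma> has_vector_derivative X (\<gamma> t)) (at t within I))"

text \<open>The attractor of a field such as \<open>vfield q\<close> with \<open>q \<noteq> 0\<close>: a singularity attracting
  every point of the sphere except its antipode.\<close>

definition attractor :: "(quat \<Rightarrow> quat) \<Rightarrow> quat \<Rightarrow> bool" where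
  "attractor X p \<longleftrightarrow> p \<in> S3 \<and> X p = 0 \<and>
     (\<forall>\<gamma>. integral_curve X \<gamma> {0..} \<and> \<gamma> 0 \<noteq> - p \<longrightarrow> (\<gamma> \<longlongrightarrow> p) at_top)"

definition great_circle :: "quat set \<Rightarrow> bool" where
  "great_circle K \<longleftrightarrow> (\<exists>V. subspace V \<and> dim V = 2 \<and> K = V \<inter> S3)"

text \<open>For \<open>T = 0\<close> the partition is the single point 0 (\<open>n = 0\<close>). At the endpoints of the
  subintervals the derivative is one-sided.\<close>

definition trajectory :: "(quat \<Rightarrow> quat) set \<Rightarrow> (real \<Rightarrow> quat) \<Rightarrow> real \<Rightarrow> bool" where
  "trajectory \<Gamma> \<gamma> T \<longleftrightarrow>
     0 \<le> T \<and> continuous_on {0..T} \<gamma> \<and> \<gamma> ` {0..T} \<subseteq> S3 \<and>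
     (\<exists>n (t :: nat \<Rightarrow> real). t 0 = 0 \<and> t n = T \<and>
        (\<forall>i<n. t i < t (Suc i) \<and> (\<exists>X\<in>\<Gamma>. integral_curve X \<gamma> {t i..t (Suc i)})))"

text \<open>On the half-line the switching times may be infinite in number but do not accumulate.\<close>

definition infinite_trajectory :: "(quat \<Rightarrow> quat) set \<Rightarrow> (real \<Rightarrow> quat) \<Rightarrow> bool" where
  "infinite_trajectory \<Gamma> \<gamma> \<longleftrightarrow> (\<forall>T\<ge>0. trajectory \<Gamma> \<gamma> T)"

definition pos_orbit :: "(quat \<Rightarrow> quat) set \<Rightarrow> quat \<Rightarrow> quat set" where
  "pos_orbit \<Gamma> x = {\<gamma> T | \<gamma> T. trajectory \<Gamma> \<gamma> T \<and> \<gamma> 0 = x}"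

definition control_set_conditions :: "(quat \<Rightarrow> quat) set \<Rightarrow> quat set \<Rightarrow> bool" where
  "control_set_conditions \<Gamma> C \<longleftrightarrow>
     (\<forall>x\<in>C. \<exists>\<gamma>. infinite_trajectory \<Gamma> \<gamma> \<and> \<gamma> 0 = x \<and> (\<forall>t\<ge>0. \<gamma> t \<in> C)) \<and>
     (\<forall>x\<in>C. closure C = closure (pos_orbit \<Gamma> x))"

definition invariant_control_set :: "(quat \<Rightarrow> quat) set \<Rightarrow> quat set \<Rightarrow> bool" where
  "invariant_control_set \<Gamma> C \<longleftrightarrow>
     C \<noteq> {} \<and> C \<subseteq> S3 \<and> control_set_conditions \<Gamma> C \<and>
     (\<forall>C'. C \<subseteq> C' \<and> C' \<subseteq> S3 \<and> control_set_conditions \<Gamma> C' \<longrightarrow> C' = C)"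

definition co :: "quat set \<Rightarrow> quat set" where
  "co A = {\<Sum>i=1..n. a i *\<^sub>R p i | (n :: nat) a p. \<forall>i\<in>{1..n}. 0 \<le> a i \<and> p i \<in> A}"

definition spherical_closed_convex_hull :: "quat set \<Rightarrow> quat set" where
  "spherical_closed_convex_hull A = S3 \<inter> closure (co A)"

end

theory Submission
  imports Defs
begin

text \<open>On the sphere the field of \<open>q\<close> is the tangential part of the constant field \<open>q\<close> of $R^4$: its
  forward integral curve from \<open>x\<close> moves, with a certain speed, along the radial projection of the
  ray \<open>x + s q\<close>, \<open>s \<ge> 0\<close>. Hence, for a set \<open>Q\<close> of quaternions, the
  trajectories of \<open>vfield ` Q\<close> from \<open>x\<close> are the projections of the polygonal paths that start at
  \<open>x\<close> and have their edges in the directions of \<open>Q\<close>. The positive orbit of \<open>x\<close> lies in the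
  cone spanned by \<open>x\<close> and \<open>Q\<close> (\<open>pos_orbit_subset_cone\<close>); and when \<open>Q\<close> lies in the open
  half-space of a vector \<open>e\<close> and \<open>x\<close> in the closed one, no such path meets the origin or the
  repelling point of the next field, so every \<open>sgn (x + w)\<close> with \<open>w \<in> co Q\<close> is reached
  (\<open>pos_orbit_push_cone\<close>).

  Let \<open>H\<close> be the spherical closed convex hull of \<open>Q\<close>. It is invariant, being the trace of a closed
  convex cone. Replacing \<open>w\<close> by its large multiples makes the summand \<open>x\<close> negligible, so the
  closure of every orbit that meets the closed half-space contains \<open>H\<close>. Consequently
  orbits of points of \<open>H\<close> are dense in \<open>H\<close>, and \<open>H\<close> satisfies the two conditions on a control
  set.

  Conversely let \<open>C\<close> satisfy them. From any point some field that does not have it as its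
  repelling point leads into the half-space, so the closure of \<open>C\<close> contains \<open>H\<close> and in particular
  an attractor \<open>p\<close>. Points \<open>y\<close> of \<open>C\<close> close to \<open>p\<close> have, up to closure, all of \<open>C\<close> in their
  orbits, which lie in the cone spanned by \<open>y\<close> and \<open>Q\<close>; as \<open>y\<close> tends to \<open>p\<close> this cone shrinks
  to that of \<open>Q\<close>, and \<open>C \<subseteq> H\<close> follows (\<open>control_set_conditions_subset_hull\<close>). So \<open>H\<close> is the
  largest set with the two conditions, hence the only maximal one.

  In the theorem all three quaternions have real part 1, so \<open>e\<close> is \<open>qone\<close>. The great circle
  condition ensures that \<open>qone\<close> and \<open>p\<^sub>1\<close>, and with them the repelling points of their fields,
  differ: otherwise a great circle through \<open>qone\<close> and \<open>p\<^sub>2\<close> would contain all three points.\<close>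

section \<open>Integral curves as projected rays\<close>

text \<open>Projecting the ray \<open>x + s(t) q\<close> to the sphere gives an integral curve exactly when the speed of
  \<open>s\<close> is the norm \<open>N\<close> of \<open>x + s(t) q\<close>. Then the derivative of \<open>N\<close> is
  \<open>inner q (x + s(t) q)\<close>, so $N'' = |q|^2 N$, and hyperbolic functions solve
  the equation. The lower bound shows that \<open>s\<close> takes all values \<open>\<ge> 0\<close> unless
  \<open>inner x q = - norm q\<close>, i.e. unless \<open>x\<close> is the repelling point \<open>- sgn q\<close>.\<close>

lemma integral_curve_through:
  assumes x: "x \<in> S3" and q: "q \<noteq> 0"
  obtains s where "s 0 = 0" and "continuous_on UNIV s"
    and "\<And>t. 0 \<le> t \<Longrightarrow> (norm q + inner x q) / (2 * norm q) * t \<le> s t"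
    and "\<And>I. integral_curve (vfield q) (\<lambda>t. sgn (x + s t *\<^sub>R q)) I"
proof -
  define m where "m = norm q"
  define k where "k = inner x q / m"
  define s where "s = (\<lambda>t. (sinh (m * t) + k * (cosh (m * t) - 1)) / m)"
  define N where "N = (\<lambda>t. cosh (m * t) + k * sinh (m * t))"
  have m: "m > 0" and nx: "norm x = 1"
    using q x by (auto simp: m_def)
  have xq: "inner x q = k * m" and qq: "inner q q = m\<^sup>2"
    using m by (auto simp: k_def m_def power2_norm_eq_inner)
  have k: "\<bar>k\<bar> \<le> 1"
    using Cauchy_Schwarz_ineq2[of x q] m nx by (simp add: k_def m_def abs_mult)
  have N_pos: "N t > 0" for t
  proof -
    have "\<bar>sinh (m * t)\<bar> < cosh (m * t)"
      using cosh_minus_sinh[of "m * t"] cosh_plus_sinh[of "m * t"]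
        exp_gt_zero[of "m * t"] exp_gt_zero[of "- (m * t)"] by linarith
    moreover have "\<bar>k * sinh (m * t)\<bar> \<le> 1 * \<bar>sinh (m * t)\<bar>"
      unfolding abs_mult by (intro mult_right_mono k) auto
    ultimately show ?thesis by (simp add: N_def)
  qed
  have norm_eq: "norm (x + s t *\<^sub>R q) = N t" for t
  proof -
    define u where "u = m * s t"
    have u: "u = sinh (m * t) + k * (cosh (m * t) - 1)"
      using m by (simp add: u_def s_def)
    have "(norm (x + s t *\<^sub>R q))\<^sup>2 = 1 + 2 * k * u + u\<^sup>2"
      unfolding power2_norm_eq_inner
      using nx xq qq
      by (simp add: inner_add_left inner_add_right inner_commute[of q x] u_def
          power2_eq_square norm_eq_1 algebra_simps)
    also have "\<dots> = (N t)\<^sup>2"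
      unfolding u N_def using cosh_square_eq[of "m * t"] by algebra
    finally show ?thesis
      using N_pos[of t] by (simp add: power2_eq_iff_nonneg)
  qed
  have s_deriv: "(s has_real_derivative N t) (at t)" for t
    unfolding s_def N_def using m
    by (auto intro!: derivative_eq_intros simp: field_simps)
  have N_deriv: "(N has_real_derivative inner q (x + s t *\<^sub>R q)) (at t)" for t
  proof -
    have "(N has_real_derivative m * (sinh (m * t) + k * cosh (m * t))) (at t)"
      unfolding N_def by (auto intro!: derivative_eq_intros simp: algebra_simps)
    moreover have "inner q (x + s t *\<^sub>R q) = m * (k + m * s t)"
      using xq qq by (simp add: inner_add_right inner_commute[of q x] power2_eq_square algebra_simps)
    moreover have "m * s t = sinh (m * t) + k * (cosh (m * t) - 1)"
      using m by (simp add: s_def)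
    ultimately show ?thesis
      by (simp add: algebra_simps)
  qed
  have sgn_eq: "sgn (x + s t *\<^sub>R q) = (1 / N t) *\<^sub>R (x + s t *\<^sub>R q)" for t
    by (simp add: sgn_div_norm norm_eq divide_inverse)
  have curve: "integral_curve (vfield q) (\<lambda>t. sgn (x + s t *\<^sub>R q)) I" for I
    unfolding integral_curve_def
  proof (intro ballI conjI)
    fix t
    let ?y = "x + s t *\<^sub>R q"
    have y0: "?y \<noteq> 0" using norm_eq[of t] N_pos[of t] by auto
    show S: "sgn ?y \<in> S3" using y0 by (simp add: norm_sgn)
    have dy: "((\<lambda>t. x + s t *\<^sub>R q) has_vector_derivative N t *\<^sub>R q) (at t)"
      by (auto intro!: derivative_eq_intros s_deriv)
    have dN: "((\<lambda>t. 1 / N t) has_real_derivative - (inner q ?y / (N t)\<^sup>2)) (at t)"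
      using N_pos[of t]
      by (auto intro!: derivative_eq_intros N_deriv simp: power2_eq_square)
    have "((\<lambda>t. sgn (x + s t *\<^sub>R q)) has_vector_derivative
            (1 / N t) *\<^sub>R (N t *\<^sub>R q) + (- (inner q ?y / (N t)\<^sup>2)) *\<^sub>R ?y) (at t)"
      unfolding sgn_eq by (rule has_vector_derivative_scaleR[OF dN dy])
    also have "(1 / N t) *\<^sub>R (N t *\<^sub>R q) + (- (inner q ?y / (N t)\<^sup>2)) *\<^sub>R ?y = vfield q (sgn ?y)"
      unfolding vfield_on_S3[OF S] unfolding sgn_eq using N_pos[of t]
      by (simp add: power2_eq_square)
    finally show "((\<lambda>t. sgn (x + s t *\<^sub>R q)) has_vector_derivative vfield q (sgn ?y)) (at t within I)"
      by (rule has_vector_derivative_at_within)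
  qed
  have bound: "(norm q + inner x q) / (2 * norm q) * t \<le> s t" if t: "0 \<le> t" for t
  proof -
    \<comment> \<open>The growing exponential is bounded below by its tangent at 0, the decaying one above by 1.\<close>
    have "(1 + k) * (1 + m * t) \<le> (1 + k) * exp (m * t)"
      using k by (intro mult_left_mono exp_ge_add_one_self) auto
    moreover have "(1 - k) * exp (- (m * t)) \<le> (1 - k) * 1"
      using k m t by (intro mult_left_mono) auto
    moreover have "2 * (m * s t) = (1 + k) * exp (m * t) - (1 - k) * exp (- (m * t)) - 2 * k"
      using m by (simp add: s_def sinh_def cosh_def field_simps)
    ultimately have "(1 + k) * (m * t) \<le> 2 * (m * s t)"
      by (simp add: algebra_simps)
    then have "m * ((1 + k) * t) \<le> m * (2 * s t)"
      by (simp add: algebra_simps)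
    then have "(1 + k) * t \<le> 2 * s t"
      using m by simp
    moreover have "(norm q + inner x q) / (2 * norm q) * t = (1 + k) * t / 2"
      using m unfolding xq m_def[symmetric] by (simp add: field_simps)
    ultimately show ?thesis by simp
  qed
  show ?thesis
  proof (rule that)
    show "s 0 = 0" by (simp add: s_def)
    show "continuous_on UNIV s"
      using s_deriv by (meson DERIV_isCont continuous_at_imp_continuous_on)
  qed (use bound curve in auto)
qed

text \<open>Here the curve is arbitrary. The equation is linear with the scalar coefficient
  \<open>- inner q (\<gamma> t)\<close>; multiplying by an integrating factor turns it into one whose
  right-hand side is a positive multiple of \<open>q\<close>. This replaces an appeal to the uniqueness of
  integral curves.\<close>

lemma integral_curve_in_cone:
  assumes \<gamma>: "integral_curve (vfield q) \<gamma> {a..b}" and ab: "a \<le> b"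
  obtains \<alpha> \<beta> where "0 \<le> \<alpha>" "0 \<le> \<beta>" "\<gamma> b = \<alpha> *\<^sub>R \<gamma> a + \<beta> *\<^sub>R q"
proof -
  have der: "(\<gamma> has_vector_derivative q - inner q (\<gamma> t) *\<^sub>R \<gamma> t) (at t within {a..b})"
    if "t \<in> {a..b}" for t
    using \<gamma> that vfield_on_S3[of "\<gamma> t" q] unfolding integral_curve_def by metis
  then have cont: "continuous_on {a..b} \<gamma>"
    by (meson continuous_on_eq_continuous_within has_vector_derivative_continuous)
  define g where "g = (\<lambda>u. integral {a..u} (\<lambda>t. inner q (\<gamma> t)))"
  have g: "(g has_real_derivative inner q (\<gamma> t)) (at t within {a..b})" if "t \<in> {a..b}" for t
    unfolding g_def has_real_derivative_iff_has_vector_derivative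
    by (rule integral_has_vector_derivative[OF _ that]) (intro continuous_intros cont)
  have eg: "((\<lambda>t. exp (g t)) has_real_derivative exp (g t) * inner q (\<gamma> t)) (at t within {a..b})"
    if "t \<in> {a..b}" for t
    using g[OF that] by (auto intro!: derivative_eq_intros)
  have "((\<lambda>t. exp (g t) *\<^sub>R \<gamma> t) has_vector_derivative exp (g t) *\<^sub>R q) (at t within {a..b})"
    if "t \<in> {a..b}" for t
    using has_vector_derivative_scaleR[OF eg[OF that] der[OF that]]
    by (simp add: algebra_simps)
  then have "((\<lambda>t. exp (g t) *\<^sub>R q) has_integral exp (g b) *\<^sub>R \<gamma> b - exp (g a) *\<^sub>R \<gamma> a) {a..b}"
    by (intro fundamental_theorem_of_calculus ab) auto
  moreover have "continuous_on {a..b} (\<lambda>t. exp (g t))"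
    unfolding continuous_on_eq_continuous_within using eg DERIV_continuous by blast
  then have int: "(\<lambda>t. exp (g t)) integrable_on {a..b}"
    by (rule integrable_continuous_real)
  then have "((\<lambda>t. exp (g t) *\<^sub>R q) has_integral integral {a..b} (\<lambda>t. exp (g t)) *\<^sub>R q) {a..b}"
    by (intro has_integral_scaleR_left integrable_integral)
  ultimately have eq: "exp (g b) *\<^sub>R \<gamma> b - exp (g a) *\<^sub>R \<gamma> a = integral {a..b} (\<lambda>t. exp (g t)) *\<^sub>R q"
    by (rule has_integral_unique)
  show ?thesis
  proof (rule that)
    show "0 \<le> exp (- g b)" by simp
    show "0 \<le> exp (- g b) * integral {a..b} (\<lambda>t. exp (g t))"
      by (intro mult_nonneg_nonneg integral_nonneg int) auto
    have "g a = 0" by (simp add: g_def)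
    have "\<gamma> b = exp (- g b) *\<^sub>R (exp (g b) *\<^sub>R \<gamma> b)"
      by (simp add: exp_minus)
    also have "exp (g b) *\<^sub>R \<gamma> b = \<gamma> a + integral {a..b} (\<lambda>t. exp (g t)) *\<^sub>R q"
      using eq \<open>g a = 0\<close> by (simp add: algebra_simps)
    finally show "\<gamma> b = exp (- g b) *\<^sub>R \<gamma> a + (exp (- g b) * integral {a..b} (\<lambda>t. exp (g t))) *\<^sub>R q"
      by (simp add: scaleR_add_right)
  qed
qed

section \<open>Conic hulls\<close>

lemma co_eq_convex_cone_hull: "co A = convex_cone hull A"
proof
  show "co A \<subseteq> convex_cone hull A"
  proof
    fix x assume "x \<in> co A"
    then obtain n a p where x: "x = (\<Sum>i=1..n::nat. a i *\<^sub>R p i)"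
      and ap: "\<forall>i\<in>{1..n}. 0 \<le> a i \<and> p i \<in> A"
      by (auto simp: co_def)
    have "(\<Sum>i\<in>J. a i *\<^sub>R p i) \<in> convex_cone hull A" if "finite J" "J \<subseteq> {1..n}" for J
      using that
    proof (induction J rule: finite_induct)
      case (insert j J)
      then have "a j *\<^sub>R p j \<in> convex_cone hull A" "(\<Sum>i\<in>J. a i *\<^sub>R p i) \<in> convex_cone hull A"
        using ap by (auto intro!: convex_cone_hull_mul intro: hull_inc)
      then show ?case
        using insert.hyps by (simp add: convex_cone_hull_add)
    qed (simp add: convex_cone_hull_contains_0)
    then show "x \<in> convex_cone hull A" by (simp add: x)
  qed
  show "convex_cone hull A \<subseteq> co A"
  proof (rule hull_minimal)
    show "A \<subseteq> co A"
    proof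
      fix x assume "x \<in> A"
      then show "x \<in> co A"
        unfolding co_def by (auto intro!: exI[of _ "1::nat"] exI[of _ "\<lambda>_. 1"] exI[of _ "\<lambda>_. x"])
    qed
    have zero: "0 \<in> co A"
      unfolding co_def by (auto intro!: exI[of _ "0::nat"])
    have add: "x + y \<in> co A" if xy: "x \<in> co A" "y \<in> co A" for x y
    proof -
      obtain n a p where x: "x = (\<Sum>i=1..n::nat. a i *\<^sub>R p i)"
        and ap: "\<forall>i\<in>{1..n}. 0 \<le> a i \<and> p i \<in> A"
        using xy(1) by (auto simp: co_def)
      obtain m b r where y: "y = (\<Sum>i=1..m::nat. b i *\<^sub>R r i)"
        and br: "\<forall>i\<in>{1..m}. 0 \<le> b i \<and> r i \<in> A"
        using xy(2) by (auto simp: co_def)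
      \<comment> \<open>The two families are put one after the other, with index ranges \<open>1..n\<close> and \<open>n+1..n+m\<close>.\<close>
      define c where "c = (\<lambda>i. if i \<le> n then a i else b (i - n))"
      define d where "d = (\<lambda>i. if i \<le> n then p i else r (i - n))"
      have "(\<Sum>i=1..n+m. c i *\<^sub>R d i) = (\<Sum>i=1..n. c i *\<^sub>R d i) + (\<Sum>i=n+1..n+m. c i *\<^sub>R d i)"
        by (rule sum.ub_add_nat) simp
      also have "(\<Sum>i=1..n. c i *\<^sub>R d i) = x"
        unfolding x by (rule sum.cong) (auto simp: c_def d_def)
      also have "(\<Sum>i=n+1..n+m. c i *\<^sub>R d i) = y"
        unfolding y
        by (rule sum.reindex_bij_witness[of _ "\<lambda>i. i + n" "\<lambda>i. i - n"]) (auto simp: c_def d_def)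
      finally have "x + y = (\<Sum>i=1..n+m. c i *\<^sub>R d i)" by simp
      moreover have "\<forall>i\<in>{1..n+m}. 0 \<le> c i \<and> d i \<in> A"
      proof
        fix i assume i: "i \<in> {1..n+m}"
        show "0 \<le> c i \<and> d i \<in> A"
        proof (cases "i \<le> n")
          case True
          then show ?thesis using ap i by (simp add: c_def d_def)
        next
          case False
          then have "i - n \<in> {1..m}" using i by auto
          then show ?thesis using br False by (simp add: c_def d_def)
        qed
      qed
      ultimately show ?thesis unfolding co_def by blast
    qed
    have scale: "t *\<^sub>R x \<in> co A" if tx: "x \<in> co A" "0 \<le> t" for x t
    proof -
      obtain n a p where x: "x = (\<Sum>i=1..n::nat. a i *\<^sub>R p i)"
        and ap: "\<forall>i\<in>{1..n}. 0 \<le> a i \<and> p i \<in> A"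
        using tx(1) by (auto simp: co_def)
      have "t *\<^sub>R x = (\<Sum>i=1..n. (t * a i) *\<^sub>R p i)"
        by (simp add: x scaleR_sum_right)
      moreover have "\<forall>i\<in>{1..n}. 0 \<le> t * a i \<and> p i \<in> A"
        using ap tx(2) by simp
      ultimately show ?thesis
        unfolding co_def mem_Collect_eq by (intro exI[of _ n] exI[of _ "\<lambda>i. t * a i"] exI[of _ p] conjI)
    qed
    show "convex_cone (co A)"
      unfolding convex_cone_iff using zero add scale by auto
  qed
qed

lemma convex_cone_closure:
  fixes K :: "'a::real_normed_vector set"
  assumes "convex_cone K"
  shows "convex_cone (closure K)"
  unfolding convex_cone_iff
proof (intro conjI ballI allI impI)
  fix x y assume "x \<in> closure K" "y \<in> closure K"
  then obtain f g where "\<And>n. f n \<in> K" "f \<longlonglongrightarrow> x" "\<And>n. g n \<in> K" "g \<longlonglongrightarrow> y"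
    by (auto simp: closure_sequential)
  then show "x + y \<in> closure K"
    unfolding closure_sequential
    by (intro exI[of _ "\<lambda>n. f n + g n"]) (auto intro!: tendsto_add convex_cone_add assms)
next
  fix x and c :: real assume "x \<in> closure K" "0 \<le> c"
  then obtain f where "\<And>n. f n \<in> K" "f \<longlonglongrightarrow> x"
    by (auto simp: closure_sequential)
  then show "c *\<^sub>R x \<in> closure K"
    unfolding closure_sequential using \<open>0 \<le> c\<close>
    by (intro exI[of _ "\<lambda>n. c *\<^sub>R f n"]) (auto intro!: tendsto_intros convex_cone_scaleR assms)
qed (use assms closure_subset convex_cone_contains_0 in fastforce)


lemma co_sgn_image: "co (sgn ` Q) = co Q"
  unfolding co_eq_convex_cone_hull
proof
  have "sgn q \<in> convex_cone hull Q" if "q \<in> Q" for q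
    unfolding sgn_div_norm using that by (intro convex_cone_hull_mul hull_inc) auto
  then show "convex_cone hull (sgn ` Q) \<subseteq> convex_cone hull Q"
    by (intro hull_minimal convex_cone_convex_cone_hull) auto
  have "q \<in> convex_cone hull (sgn ` Q)" if "q \<in> Q" for q
  proof -
    have "norm q *\<^sub>R sgn q \<in> convex_cone hull (sgn ` Q)"
      using that by (intro convex_cone_hull_mul hull_inc) auto
    moreover have "norm q *\<^sub>R sgn q = q"
      by (cases "q = 0") (simp_all add: sgn_div_norm)
    ultimately show ?thesis by simp
  qed
  then show "convex_cone hull Q \<subseteq> convex_cone hull (sgn ` Q)"
    by (intro hull_minimal convex_cone_convex_cone_hull) auto
qed

lemma inner_closure_co_nonneg:
  assumes e: "\<And>q. q \<in> Q \<Longrightarrow> 0 < inner e q" and w: "w \<in> closure (co Q)"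
  shows "0 \<le> inner e w"
proof -
  have "co Q \<subseteq> {x. inner e x \<ge> 0}"
    unfolding co_eq_convex_cone_hull
    by (rule hull_minimal) (use e convex_cone_halfspace_ge in \<open>auto intro: less_imp_le\<close>)
  then have "closure (co Q) \<subseteq> {x. inner e x \<ge> 0}"
    by (rule closure_minimal) (rule closed_halfspace_ge)
  with w show ?thesis by auto
qed

section \<open>Trajectories and positive orbits\<close>

lemma trajectory_integral_curve:
  assumes "X \<in> \<Gamma>" and \<gamma>: "integral_curve X \<gamma> {0..T}" and T: "0 \<le> T"
  shows "trajectory \<Gamma> \<gamma> T"
proof -
  have "continuous_on {0..T} \<gamma>"
    using \<gamma> unfolding integral_curve_def
    by (meson continuous_on_eq_continuous_within has_vector_derivative_continuous)
  moreover have "\<gamma> ` {0..T} \<subseteq> S3"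
    using \<gamma> by (auto simp: integral_curve_def)
  moreover have "\<exists>n (t :: nat \<Rightarrow> real). t 0 = 0 \<and> t n = T \<and>
        (\<forall>i<n. t i < t (Suc i) \<and> (\<exists>X\<in>\<Gamma>. integral_curve X \<gamma> {t i..t (Suc i)}))"
  proof (cases "T = 0")
    case True
    then show ?thesis by (intro exI[of _ 0] exI[of _ "\<lambda>_. 0"]) auto
  next
    case False
    then show ?thesis
      using assms by (intro exI[of _ "Suc 0"] exI[of _ "\<lambda>i. if i = 0 then 0 else T"]) auto
  qed
  ultimately show ?thesis using T by (simp add: trajectory_def)
qed

lemma pos_orbit_refl:
  assumes "x \<in> S3"
  shows "x \<in> pos_orbit \<Gamma> x"
proof -
  have "trajectory \<Gamma> (\<lambda>_. x) 0"
    unfolding trajectory_def using assms by (auto intro!: exI[of _ "0::nat"] exI[of _ "\<lambda>_. 0"])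
  then show ?thesis unfolding pos_orbit_def by fastforce
qed

lemma integral_curve_cong:
  assumes "integral_curve X \<gamma> I" and eq: "\<And>t. t \<in> I \<Longrightarrow> \<delta> t = \<gamma> t"
  shows "integral_curve X \<delta> I"
  unfolding integral_curve_def
proof
  fix t assume t: "t \<in> I"
  have "(\<gamma> has_vector_derivative X (\<gamma> t)) (at t within I)" "\<gamma> t \<in> S3"
    using assms(1) t by (auto simp: integral_curve_def)
  then show "\<delta> t \<in> S3 \<and> (\<delta> has_vector_derivative X (\<delta> t)) (at t within I)"
    using has_vector_derivative_transform[OF t, of \<delta> \<gamma>] eq t by simp
qed

lemma integral_curve_shift:
  assumes "integral_curve X \<gamma> {a..b}"
  shows "integral_curve X (\<lambda>t. \<gamma> (t - c)) {a + c..b + c}"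
  unfolding integral_curve_def
proof
  fix t assume t: "t \<in> {a + c..b + c}"
  have img: "(\<lambda>t. t - c) ` {a + c..b + c} = {a..b}"
    by (simp add: image_diff_atLeastAtMost)
  have \<gamma>: "\<gamma> (t - c) \<in> S3" "(\<gamma> has_vector_derivative X (\<gamma> (t - c))) (at (t - c) within {a..b})"
    using assms t by (auto simp: integral_curve_def)
  have "((\<lambda>t. t - c) has_vector_derivative 1) (at t within {a + c..b + c})"
    by (auto intro!: derivative_eq_intros)
  from vector_diff_chain_within[OF this, of \<gamma>] \<gamma>
  show "\<gamma> (t - c) \<in> S3 \<and>
      ((\<lambda>t. \<gamma> (t - c)) has_vector_derivative X (\<gamma> (t - c))) (at t within {a + c..b + c})"
    by (simp add: img o_def)
qed

lemma pos_orbit_extend: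
  assumes y: "y \<in> pos_orbit \<Gamma> x" and X: "X \<in> \<Gamma>"
    and \<delta>: "integral_curve X \<delta> {0..r}" "\<delta> 0 = y" and r: "0 \<le> r"
  shows "\<delta> r \<in> pos_orbit \<Gamma> x"
proof (cases "r = 0")
  case True
  then show ?thesis using y \<delta> by simp
next
  case False
  with r have r: "r > 0" by simp
  obtain \<gamma> T where \<gamma>: "trajectory \<Gamma> \<gamma> T" "\<gamma> 0 = x" "\<gamma> T = y"
    using y by (auto simp: pos_orbit_def)
  obtain n and t :: "nat \<Rightarrow> real" where T: "0 \<le> T" and cont: "continuous_on {0..T} \<gamma>"
    and sub: "\<gamma> ` {0..T} \<subseteq> S3" and t: "t 0 = 0" "t n = T"
    and step: "\<And>i. i < n \<Longrightarrow> t i < t (Suc i) \<and> (\<exists>X\<in>\<Gamma>. integral_curve X \<gamma> {t i..t (Suc i)})"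
    using \<gamma>(1) unfolding trajectory_def by blast
  have mono: "\<And>i. i < n \<Longrightarrow> t i < t (Suc i)" using step by blast
  define \<eta> where "\<eta> = (\<lambda>u. if u \<le> T then \<gamma> u else \<delta> (u - T))"
  have \<eta>1: "\<eta> u = \<gamma> u" if "u \<le> T" for u
    using that by (simp add: \<eta>_def)
  have \<eta>2: "\<eta> u = \<delta> (u - T)" if "T \<le> u" for u
    using that \<gamma>(3) \<delta>(2) by (auto simp: \<eta>_def)
  have le_T: "t i \<le> T" if "i \<le> n" for i
    using that
  proof (induction rule: inc_induct)
    case (step k)
    have "t k < t (Suc k)" using step.hyps(2) mono by blast
    then show ?case using step.IH by simp
  qed (simp add: t)
  have last: "integral_curve X \<eta> {T..T + r}"
    using integral_curve_cong[OF integral_curve_shift[OF \<delta>(1), of T], of \<eta>] \<eta>2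
    by (simp add: add.commute)
  have split: "{0..T + r} = {0..T} \<union> {T..T + r}"
    using T r by auto
  have "continuous_on {0..T + r} \<eta>"
    unfolding split
  proof (rule continuous_on_closed_Un)
    show "continuous_on {0..T} \<eta>"
      using cont by (rule continuous_on_eq) (simp add: \<eta>1)
    show "continuous_on {T..T + r} \<eta>"
      using last unfolding integral_curve_def
      by (meson continuous_on_eq_continuous_within has_vector_derivative_continuous)
  qed auto
  moreover have "\<eta> ` {0..T + r} \<subseteq> S3"
    using sub last \<eta>1 unfolding split integral_curve_def by fastforce
  moreover have "\<exists>n (t :: nat \<Rightarrow> real). t 0 = 0 \<and> t n = T + r \<and>
        (\<forall>i<n. t i < t (Suc i) \<and> (\<exists>X\<in>\<Gamma>. integral_curve X \<eta> {t i..t (Suc i)}))"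
  proof (intro exI conjI allI impI)
    let ?t = "\<lambda>i. if i \<le> n then t i else T + r"
    show "?t 0 = 0" "?t (Suc n) = T + r" using t by auto
    fix i assume "i < Suc n"
    then consider "i < n" | "i = n" by linarith
    then have "?t i < ?t (Suc i) \<and> (\<exists>X\<in>\<Gamma>. integral_curve X \<eta> {?t i..?t (Suc i)})"
    proof cases
      case 1
      then obtain Y where Y: "Y \<in> \<Gamma>" "integral_curve Y \<gamma> {t i..t (Suc i)}"
        using step by blast
      have "integral_curve Y \<eta> {t i..t (Suc i)}"
        by (rule integral_curve_cong[OF Y(2)]) (use 1 le_T[of "Suc i"] \<eta>1 in auto)
      then show ?thesis using 1 Y(1) step[OF 1] by auto
    next
      case 2
      then show ?thesis using last X r t by auto
    qed
    then show "?t i < ?t (Suc i)" "\<exists>X\<in>\<Gamma>. integral_curve X \<eta> {?t i..?t (Suc i)}"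
      by blast+
  qed
  ultimately have "trajectory \<Gamma> \<eta> (T + r)"
    using T r by (simp add: trajectory_def)
  moreover have "\<eta> 0 = x" "\<eta> (T + r) = \<delta> r"
    using \<eta>1[OF T] \<eta>2[of "T + r"] \<gamma>(2) r by auto
  ultimately show ?thesis
    unfolding pos_orbit_def mem_Collect_eq by metis
qed

text \<open>Each piece of a trajectory rescales the position and adds a nonnegative multiple of an element of
  \<open>Q\<close>; induction over the switching times.\<close>

lemma pos_orbit_subset_cone:
  assumes y: "y \<in> pos_orbit (vfield ` Q) x"
  obtains \<alpha> w where "0 \<le> \<alpha>" "w \<in> co Q" "y = \<alpha> *\<^sub>R x + w" "y \<in> S3"
proof -
  obtain \<gamma> T where \<gamma>: "trajectory (vfield ` Q) \<gamma> T" "\<gamma> 0 = x" "\<gamma> T = y"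
    using y by (auto simp: pos_orbit_def)
  obtain n and t :: "nat \<Rightarrow> real" where T: "0 \<le> T"
    and sub: "\<gamma> ` {0..T} \<subseteq> S3" and t: "t 0 = 0" "t n = T"
    and step: "\<And>i. i < n \<Longrightarrow> t i < t (Suc i) \<and> (\<exists>X\<in>vfield ` Q. integral_curve X \<gamma> {t i..t (Suc i)})"
    using \<gamma>(1) unfolding trajectory_def by blast
  have "\<exists>\<alpha>\<ge>0. \<exists>w\<in>co Q. \<gamma> (t i) = \<alpha> *\<^sub>R x + w" if "i \<le> n" for i
    using that
  proof (induction i)
    case 0
    then show ?case
      by (intro exI[of _ 1] conjI bexI[of _ 0])
        (auto simp: t \<gamma> co_eq_convex_cone_hull convex_cone_hull_contains_0)
  next
    case (Suc i)
    then obtain \<alpha> w where IH: "0 \<le> \<alpha>" "w \<in> co Q" "\<gamma> (t i) = \<alpha> *\<^sub>R x + w"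
      by auto
    obtain q where q: "q \<in> Q" "integral_curve (vfield q) \<gamma> {t i..t (Suc i)}"
      using step Suc.prems by (metis Suc_le_lessD imageE)
    obtain a b where ab: "0 \<le> a" "0 \<le> b" "\<gamma> (t (Suc i)) = a *\<^sub>R \<gamma> (t i) + b *\<^sub>R q"
      using integral_curve_in_cone[OF q(2)] step Suc.prems by (metis Suc_le_lessD less_imp_le)
    have "a *\<^sub>R w + b *\<^sub>R q \<in> co Q"
      using convex_cone_hull_add[OF convex_cone_hull_mul convex_cone_hull_mul[OF hull_inc]]
        IH(2) ab q(1) unfolding co_eq_convex_cone_hull by blast
    moreover have "\<gamma> (t (Suc i)) = (a * \<alpha>) *\<^sub>R x + (a *\<^sub>R w + b *\<^sub>R q)"
      by (simp add: ab IH scaleR_add_right)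
    ultimately show ?case using ab(1) IH(1) by (meson mult_nonneg_nonneg)
  qed
  from this[of n] obtain \<alpha> w where "0 \<le> \<alpha>" "w \<in> co Q" "y = \<alpha> *\<^sub>R x + w"
    using t \<gamma>(3) by auto
  moreover have "y \<in> S3" using sub T \<gamma>(3) by fastforce
  ultimately show ?thesis by (rule that)
qed

text \<open>From any point but the repelling one, the whole projected ray is reached. Stating this for \<open>sgn z\<close> with an
  unnormalised \<open>z\<close> allows moves to be composed by adding vectors in the ambient space.\<close>

lemma pos_orbit_push:
  assumes z: "z \<noteq> 0" "sgn z \<in> pos_orbit (vfield ` Q) x"
    and q: "q \<in> Q" "q \<noteq> 0" "sgn z \<noteq> - sgn q" and r: "0 \<le> r"
  shows "sgn (z + r *\<^sub>R q) \<in> pos_orbit (vfield ` Q) x"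
proof -
  let ?y = "sgn z"
  have y: "?y \<in> S3" using z by (simp add: norm_sgn)
  then have sgn_y: "sgn ?y = ?y" by (simp add: sgn_div_norm[of ?y])
  obtain s where s: "s 0 = 0" "continuous_on UNIV s"
    and bound: "\<And>t. 0 \<le> t \<Longrightarrow> (norm q + inner ?y q) / (2 * norm q) * t \<le> s t"
    and curve: "\<And>I. integral_curve (vfield q) (\<lambda>t. sgn (?y + s t *\<^sub>R q)) I"
    using integral_curve_through[OF y q(2)] by blast
  \<comment> \<open>The strict Cauchy-Schwarz inequality, read off from the norm of a nonzero sum of unit vectors.\<close>
  have "0 < inner (?y + sgn q) (?y + sgn q)"
    using q(3) by (simp add: add_eq_0_iff2)
  also have "\<dots> = 2 * (1 + inner ?y (sgn q))"
  proof -
    have "inner ?y ?y = 1" "inner (sgn q) (sgn q) = 1"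
      using z(1) q(2) by (simp_all add: norm_sgn flip: norm_eq_1)
    then show ?thesis
      by (simp add: inner_add_left inner_add_right inner_commute[of "sgn q" ?y])
  qed
  also have "inner ?y (sgn q) = inner ?y q / norm q"
    by (simp add: sgn_div_norm[of q] divide_inverse mult.commute)
  finally have "0 < norm q + inner ?y q"
    using q(2) by (simp add: field_simps)
  define b where "b = (norm q + inner ?y q) / (2 * norm q)"
  have b: "0 < b"
    using q(2) \<open>0 < norm q + inner ?y q\<close> by (simp add: b_def)
  define v where "v = r / norm z"
  have v: "0 \<le> v" using r by (simp add: v_def)
  have "\<exists>t\<ge>0. t \<le> v / b \<and> s t = v"
  proof (rule IVT')
    show "s 0 \<le> v" using s v by simp
    show "0 \<le> v / b" using v b by simp
    then show "v \<le> s (v / b)" using bound[of "v / b"] b by (simp flip: b_def)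
    show "continuous_on {0..v / b} s" using s(2) continuous_on_subset by blast
  qed
  then obtain t where t: "0 \<le> t" "s t = v" by blast
  have "sgn (?y + s t *\<^sub>R q) \<in> pos_orbit (vfield ` Q) x"
    by (rule pos_orbit_extend[OF z(2) _ curve]) (use q t s z in \<open>auto simp: sgn_y\<close>)
  also have "?y + s t *\<^sub>R q = (1 / norm z) *\<^sub>R (z + r *\<^sub>R q)"
    by (simp add: t v_def sgn_div_norm scaleR_add_right divide_inverse mult.commute)
  finally show ?thesis using z(1) by (simp add: sgn_scaleR)
qed

text \<open>The summands of \<open>w\<close> are added one at a time. The functional \<open>inner e\<close> stays nonnegative along
  the way, whereas it is negative at the repelling points \<open>- sgn q\<close>, so each move is possible
  and the origin is avoided.\<close>

lemma pos_orbit_push_cone: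
  assumes e: "\<And>q. q \<in> Q \<Longrightarrow> 0 < inner e q"
    and z: "z \<noteq> 0" "0 \<le> inner e z" "sgn z \<in> pos_orbit (vfield ` Q) x" and w: "w \<in> co Q"
  shows "sgn (z + w) \<in> pos_orbit (vfield ` Q) x"
proof -
  obtain n a p where w: "w = (\<Sum>i=1..n::nat. a i *\<^sub>R p i)"
    and ap: "\<forall>i\<in>{1..n}. 0 \<le> a i \<and> p i \<in> Q"
    using w by (auto simp: co_def)
  have "let u = z + (\<Sum>i=1..k. a i *\<^sub>R p i) in
          u \<noteq> 0 \<and> 0 \<le> inner e u \<and> sgn u \<in> pos_orbit (vfield ` Q) x" if "k \<le> n" for k
    using that
  proof (induction k)
    case 0
    then show ?case using z by simp
  next
    case (Suc k)
    define u where "u = z + (\<Sum>i=1..k. a i *\<^sub>R p i)"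
    define q where "q = p (Suc k)"
    define r where "r = a (Suc k)"
    have u: "u \<noteq> 0" "0 \<le> inner e u" "sgn u \<in> pos_orbit (vfield ` Q) x"
      using Suc by (auto simp: u_def Let_def)
    have q: "q \<in> Q" "0 \<le> r" using ap Suc.prems by (auto simp: q_def r_def)
    have eq: "0 < inner e q" "q \<noteq> 0" using e[OF q(1)] by auto
    have "0 \<le> inner e (sgn u)" "inner e (- sgn q) < 0"
      using u eq by (auto simp: sgn_div_norm)
    then have "sgn u \<noteq> - sgn q" by auto
    then have "sgn (u + r *\<^sub>R q) \<in> pos_orbit (vfield ` Q) x"
      using pos_orbit_push u eq q by blast
    moreover have "u + r *\<^sub>R q \<noteq> 0"
    proof (cases "r = 0")
      case False
      then have "0 < inner e (u + r *\<^sub>R q)"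
        using u q eq by (simp add: inner_add_right add_nonneg_pos)
      then show ?thesis by auto
    qed (use u in simp)
    moreover have "0 \<le> inner e (u + r *\<^sub>R q)"
      using u q eq by (simp add: inner_add_right)
    moreover have "z + (\<Sum>i=1..Suc k. a i *\<^sub>R p i) = u + r *\<^sub>R q"
      by (simp add: u_def r_def q_def)
    ultimately show ?case by (simp add: Let_def)
  qed
  from this[of n] show ?thesis by (simp add: w Let_def)
qed

text \<open>Let \<open>w\<^sub>n \<in> co Q\<close> tend to \<open>v\<close>. The reachable points \<open>sgn (z + (n + 1) w\<^sub>n)\<close> equal
  \<open>sgn (z / (n + 1) + w\<^sub>n)\<close>, which tends to \<open>sgn v = v\<close>.\<close>

lemma hull_subset_closure_pos_orbit:
  assumes e: "\<And>q. q \<in> Q \<Longrightarrow> 0 < inner e q"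
    and z: "z \<noteq> 0" "0 \<le> inner e z" "sgn z \<in> pos_orbit (vfield ` Q) x"
  shows "spherical_closed_convex_hull Q \<subseteq> closure (pos_orbit (vfield ` Q) x)"
proof
  fix v assume "v \<in> spherical_closed_convex_hull Q"
  then have v: "v \<in> S3" "v \<in> closure (co Q)"
    by (auto simp: spherical_closed_convex_hull_def)
  then obtain w where w: "\<And>n. w n \<in> co Q" "w \<longlonglongrightarrow> v"
    by (auto simp: closure_sequential)
  define y where "y = (\<lambda>n. sgn (z + real (Suc n) *\<^sub>R w n))"
  have "y n \<in> pos_orbit (vfield ` Q) x" for n
    unfolding y_def using w(1)
    by (intro pos_orbit_push_cone[OF e z]) (auto simp: co_eq_convex_cone_hull intro: convex_cone_hull_mul)
  moreover have "y \<longlonglongrightarrow> v"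
  proof -
    have y_eq: "y = (\<lambda>n. sgn (inverse (real (Suc n)) *\<^sub>R z + w n))"
    proof
      fix n
      have "z + real (Suc n) *\<^sub>R w n = real (Suc n) *\<^sub>R (inverse (real (Suc n)) *\<^sub>R z + w n)"
        by (simp add: scaleR_add_right del: of_nat_Suc)
      then show "y n = sgn (inverse (real (Suc n)) *\<^sub>R z + w n)"
        unfolding y_def by (simp add: sgn_scaleR del: of_nat_Suc)
    qed
    have "y \<longlonglongrightarrow> sgn (0 *\<^sub>R z + v)"
      unfolding y_eq
      by (intro tendsto_intros LIMSEQ_inverse_real_of_nat w) (use v in auto)
    moreover have "sgn v = v" using v by (simp add: sgn_div_norm)
    ultimately show ?thesis by simp
  qed
  ultimately show "v \<in> closure (pos_orbit (vfield ` Q) x)"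
    unfolding closure_sequential by blast
qed


section \<open>The hull is the only invariant control set\<close>

lemma pos_orbit_subset_hull:
  assumes x: "x \<in> spherical_closed_convex_hull Q"
  shows "pos_orbit (vfield ` Q) x \<subseteq> spherical_closed_convex_hull Q"
proof
  fix y assume "y \<in> pos_orbit (vfield ` Q) x"
  then obtain \<alpha> w where y: "0 \<le> \<alpha>" "w \<in> co Q" "y = \<alpha> *\<^sub>R x + w" "y \<in> S3"
    by (rule pos_orbit_subset_cone)
  have K: "convex_cone (closure (co Q))"
    unfolding co_eq_convex_cone_hull by (intro convex_cone_closure convex_cone_convex_cone_hull)
  have "x \<in> closure (co Q)" "w \<in> closure (co Q)"
    using x y(2) closure_subset by (auto simp: spherical_closed_convex_hull_def)
  then have "y \<in> closure (co Q)"
    unfolding y(3) using y(1) by (intro convex_cone_add[OF K] convex_cone_scaleR[OF K])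
  with y(4) show "y \<in> spherical_closed_convex_hull Q"
    by (simp add: spherical_closed_convex_hull_def)
qed

lemma closed_spherical_hull: "closed (spherical_closed_convex_hull Q)"
  by (simp add: spherical_closed_convex_hull_def closed_Int)

lemma control_set_conditions_hull:
  assumes e: "\<And>q. q \<in> Q \<Longrightarrow> 0 < inner e q" and "q \<in> Q"
  shows "control_set_conditions (vfield ` Q) (spherical_closed_convex_hull Q)"
  unfolding control_set_conditions_def
proof (intro conjI ballI)
  fix x assume x: "x \<in> spherical_closed_convex_hull Q"
  then have x_S3: "x \<in> S3" and x_e: "0 \<le> inner e x"
    using inner_closure_co_nonneg[OF e] by (auto simp: spherical_closed_convex_hull_def)
  have sgn_x: "sgn x = x" "x \<noteq> 0"
    using x_S3 by (auto simp: sgn_div_norm)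
  have "q \<noteq> 0" using e[OF \<open>q \<in> Q\<close>] by auto
  obtain s where s: "s 0 = 0" and "continuous_on UNIV s"
    and "\<And>t. 0 \<le> t \<Longrightarrow> (norm q + inner x q) / (2 * norm q) * t \<le> s t"
    and curve: "\<And>I. integral_curve (vfield q) (\<lambda>t. sgn (x + s t *\<^sub>R q)) I"
    using integral_curve_through[OF x_S3 \<open>q \<noteq> 0\<close>] by blast
  let ?\<gamma> = "\<lambda>t. sgn (x + s t *\<^sub>R q)"
  have "trajectory (vfield ` Q) ?\<gamma> T" if "0 \<le> T" for T
    using trajectory_integral_curve[OF _ curve that] \<open>q \<in> Q\<close> by blast
  moreover have "?\<gamma> 0 = x" by (simp add: s sgn_x)
  moreover have "?\<gamma> t \<in> spherical_closed_convex_hull Q" if "0 \<le> t" for t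
  proof -
    have "?\<gamma> t \<in> pos_orbit (vfield ` Q) x"
      by (rule pos_orbit_extend[OF pos_orbit_refl[OF x_S3] _ curve])
        (use that s sgn_x \<open>q \<in> Q\<close> in auto)
    then show ?thesis using pos_orbit_subset_hull[OF x] by blast
  qed
  ultimately show "\<exists>\<gamma>. infinite_trajectory (vfield ` Q) \<gamma> \<and> \<gamma> 0 = x \<and>
      (\<forall>t\<ge>0. \<gamma> t \<in> spherical_closed_convex_hull Q)"
    unfolding infinite_trajectory_def by (intro exI[of _ ?\<gamma>]) auto
  have "closure (pos_orbit (vfield ` Q) x) \<subseteq> spherical_closed_convex_hull Q"
    by (intro closure_minimal pos_orbit_subset_hull x closed_spherical_hull)
  moreover have "spherical_closed_convex_hull Q \<subseteq> closure (pos_orbit (vfield ` Q) x)"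
    by (rule hull_subset_closure_pos_orbit[OF e sgn_x(2) x_e])
      (use pos_orbit_refl[OF x_S3] sgn_x in auto)
  ultimately show "closure (spherical_closed_convex_hull Q) = closure (pos_orbit (vfield ` Q) x)"
    by (simp add: closed_spherical_hull closure_closed)
qed

text \<open>The closure of \<open>C\<close> contains the attractor \<open>?p = sgn q\<^sub>0\<close>, so there are \<open>y\<^sub>n \<in> C\<close> tending to
  it. A point \<open>x\<close> of \<open>C\<close> is in the closure of the orbit of each \<open>y\<^sub>n\<close> and is therefore a
  limit of points \<open>\<alpha>\<^sub>n y\<^sub>n + w\<^sub>n\<close> of the sphere with \<open>w\<^sub>n \<in> co Q\<close>. Applying \<open>inner e\<close>
  bounds \<open>\<alpha>\<^sub>n\<close>, so that \<open>y\<^sub>n\<close> can be replaced by \<open>?p\<close> in the limit; and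
  \<open>\<alpha>\<^sub>n ?p + w\<^sub>n\<close> lies in \<open>co Q\<close>.\<close>

lemma control_set_conditions_subset_hull:
  assumes e: "\<And>q. q \<in> Q \<Longrightarrow> 0 < inner e q"
    and Q: "q\<^sub>0 \<in> Q" "q\<^sub>1 \<in> Q" "sgn q\<^sub>0 \<noteq> sgn q\<^sub>1"
    and C: "C \<subseteq> S3" "control_set_conditions (vfield ` Q) C"
  shows "C \<subseteq> spherical_closed_convex_hull Q"
proof
  fix x assume x: "x \<in> C"
  let ?p = "sgn q\<^sub>0"
  have clC: "closure C = closure (pos_orbit (vfield ` Q) y)" if "y \<in> C" for y
    using C(2) that by (simp add: control_set_conditions_def)
  have x_S3: "x \<in> S3" and sgn_x: "sgn x = x" "x \<noteq> 0"
    using x C(1) by (auto simp: sgn_div_norm)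
  \<comment> \<open>First move into the half-space, along a field for which \<open>x\<close> is not the repelling point; the
    summand 1 makes the inequality strict, so that \<open>z\<close> is nonzero.\<close>
  obtain q where q: "q \<in> Q" "x \<noteq> - sgn q"
    using Q by (cases "x = - sgn q\<^sub>0") auto
  define r where "r = \<bar>inner e x\<bar> / inner e q"
  define z where "z = x + (r + 1) *\<^sub>R q"
  have r: "0 \<le> r" and ez: "0 < inner e z" and q_nz: "q \<noteq> 0"
    using e[OF q(1)] by (auto simp: r_def z_def inner_add_right algebra_simps intro: add_nonneg_pos)
  have "sgn z \<in> pos_orbit (vfield ` Q) x"
    unfolding z_def
    by (rule pos_orbit_push) (use q q_nz r sgn_x pos_orbit_refl[OF x_S3] in auto)
  moreover have "z \<noteq> 0" using ez by auto
  ultimately have hull_sub: "spherical_closed_convex_hull Q \<subseteq> closure C"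
    unfolding clC[OF x] using ez by (intro hull_subset_closure_pos_orbit[OF e]) auto
  have p_co: "?p \<in> co Q"
    unfolding co_eq_convex_cone_hull sgn_div_norm
    by (intro convex_cone_hull_mul hull_inc Q) auto
  have "q\<^sub>0 \<noteq> 0" using e[OF Q(1)] by auto
  then have p_e: "0 < inner e ?p" and p_S3: "?p \<in> S3"
    using e[OF Q(1)] by (simp_all add: norm_sgn) (simp add: sgn_div_norm)
  have "?p \<in> closure C"
    using hull_sub p_co p_S3 closure_subset[of "co Q"]
    unfolding spherical_closed_convex_hull_def by blast
  then obtain y where y: "\<And>n. y n \<in> C" "y \<longlonglongrightarrow> ?p"
    by (auto simp: closure_sequential)
  have "\<exists>x'. x' \<in> pos_orbit (vfield ` Q) (y n) \<and> dist x' x < inverse (real (Suc n))" for n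
  proof -
    have "x \<in> closure (pos_orbit (vfield ` Q) (y n))"
      using clC[OF y(1)] x closure_subset by blast
    then show ?thesis
      unfolding closure_approachable by (metis inverse_positive_iff_positive of_nat_0_less_iff zero_less_Suc)
  qed
  then obtain x' where x': "\<And>n. x' n \<in> pos_orbit (vfield ` Q) (y n)"
    and dist: "\<And>n. dist (x' n) x < inverse (real (Suc n))"
    by metis
  have "x' \<longlonglongrightarrow> x"
    by (rule metric_tendsto_imp_tendsto[OF LIMSEQ_inverse_real_of_nat])
      (use dist in \<open>auto intro!: always_eventually less_imp_le simp del: of_nat_Suc\<close>)
  have "\<exists>\<alpha> w. 0 \<le> \<alpha> \<and> w \<in> co Q \<and> x' n = \<alpha> *\<^sub>R y n + w \<and> x' n \<in> S3" for n
    using pos_orbit_subset_cone[OF x'] by metis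
  then obtain \<alpha> w where \<alpha>: "\<And>n. 0 \<le> \<alpha> n" and w: "\<And>n. w n \<in> co Q"
    and eq: "\<And>n. x' n = \<alpha> n *\<^sub>R y n + w n" and x'_S3: "\<And>n. x' n \<in> S3"
    by metis
  define u where "u = (\<lambda>n. \<alpha> n *\<^sub>R ?p + w n)"
  have u: "u n \<in> co Q" for n
    using p_co w \<alpha> unfolding u_def co_eq_convex_cone_hull
    by (intro convex_cone_hull_add convex_cone_hull_mul)
  have "(\<lambda>n. inner e (y n)) \<longlonglongrightarrow> inner e ?p"
    by (intro tendsto_intros y)
  then have "\<forall>\<^sub>F n in sequentially. inner e ?p / 2 < inner e (y n)"
    by (rule order_tendstoD) (use p_e in simp)
  define M where "M = 2 * norm e / inner e ?p"
  have bound: "\<forall>\<^sub>F n in sequentially. \<alpha> n \<le> M"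
    using \<open>\<forall>\<^sub>F n in sequentially. inner e ?p / 2 < inner e (y n)\<close>
  proof eventually_elim
    case (elim n)
    have "\<alpha> n * (inner e ?p / 2) \<le> \<alpha> n * inner e (y n)"
      using elim \<alpha>[of n] by (intro mult_left_mono) auto
    also have "\<dots> \<le> inner e (x' n)"
      using inner_closure_co_nonneg[OF e subsetD[OF closure_subset w]]
      by (simp add: eq inner_add_right)
    also have "\<dots> \<le> norm e"
      using norm_cauchy_schwarz[of e "x' n"] x'_S3[of n] by simp
    finally show ?case using p_e by (simp add: M_def field_simps)
  qed
  have null: "(\<lambda>n. \<alpha> n *\<^sub>R (?p - y n)) \<longlonglongrightarrow> 0"
  proof (rule Lim_null_comparison)
    show "\<forall>\<^sub>F n in sequentially. norm (\<alpha> n *\<^sub>R (?p - y n)) \<le> M * norm (?p - y n)"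
      using bound
    proof eventually_elim
      case (elim n)
      show ?case
        using mult_right_mono[OF elim norm_ge_zero[of "?p - y n"]] \<alpha>[of n] by simp
    qed
    have "(\<lambda>n. M * norm (?p - y n)) \<longlonglongrightarrow> M * norm (?p - ?p)"
      by (intro tendsto_intros y)
    then show "(\<lambda>n. M * norm (?p - y n)) \<longlonglongrightarrow> 0" by simp
  qed
  have "u = (\<lambda>n. x' n + \<alpha> n *\<^sub>R (?p - y n))"
    unfolding u_def eq by (simp add: scaleR_diff_right add.commute)
  with tendsto_add[OF \<open>x' \<longlonglongrightarrow> x\<close> null] have "u \<longlonglongrightarrow> x" by simp
  then have "x \<in> closure (co Q)"
    using u unfolding closure_sequential by blast
  with x_S3 show "x \<in> spherical_closed_convex_hull Q"
    by (simp add: spherical_closed_convex_hull_def)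
qed

theorem invariant_control_set_iff_hull:
  assumes e: "\<And>q. q \<in> Q \<Longrightarrow> 0 < inner e q"
    and Q: "q\<^sub>0 \<in> Q" "q\<^sub>1 \<in> Q" "sgn q\<^sub>0 \<noteq> sgn q\<^sub>1"
  shows "invariant_control_set (vfield ` Q) C \<longleftrightarrow> C = spherical_closed_convex_hull Q"
proof -
  let ?H = "spherical_closed_convex_hull Q"
  have H: "control_set_conditions (vfield ` Q) ?H"
    by (rule control_set_conditions_hull[OF e Q(1)])
  have sub: "C \<subseteq> ?H" if "C \<subseteq> S3" "control_set_conditions (vfield ` Q) C" for C
    by (rule control_set_conditions_subset_hull[OF e Q that])
  have "sgn q\<^sub>0 \<in> co Q"
    unfolding co_eq_convex_cone_hull sgn_div_norm
    by (intro convex_cone_hull_mul hull_inc Q) auto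
  moreover have "sgn q\<^sub>0 \<in> S3"
    using e[OF Q(1)] by (auto simp: norm_sgn)
  ultimately have "sgn q\<^sub>0 \<in> ?H"
    using closure_subset by (auto simp: spherical_closed_convex_hull_def)
  then have ne: "?H \<noteq> {}" and S3: "?H \<subseteq> S3"
    by (auto simp: spherical_closed_convex_hull_def)
  show ?thesis
  proof
    assume "invariant_control_set (vfield ` Q) C"
    then have "C \<subseteq> S3" "control_set_conditions (vfield ` Q) C"
      and maximal: "\<And>C'. C \<subseteq> C' \<Longrightarrow> C' \<subseteq> S3 \<Longrightarrow> control_set_conditions (vfield ` Q) C' \<Longrightarrow> C' = C"
      unfolding invariant_control_set_def by blast+
    then show "C = ?H" using sub H S3 by metis
  next
    assume "C = ?H"
    then show "invariant_control_set (vfield ` Q) C"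
      unfolding invariant_control_set_def using ne S3 H sub by blast
  qed
qed

section \<open>Attractors and great circles\<close>

text \<open>A singularity is \<open>sgn q\<close> or its antipode. The antipode is excluded by the curve that starts at a
  point orthogonal to \<open>q\<close>, since that curve stays in the half-space of \<open>q\<close>.\<close>

lemma attractor_eq_sgn:
  assumes att: "attractor (vfield q) p" and q: "q \<noteq> 0"
  shows "p = sgn q"
proof -
  define \<mu> where "\<mu> = inner q p"
  have p: "p \<in> S3" and lim: "\<And>\<gamma>. integral_curve (vfield q) \<gamma> {0..} \<Longrightarrow> \<gamma> 0 \<noteq> - p \<Longrightarrow> (\<gamma> \<longlongrightarrow> p) at_top"
    and "vfield q p = 0"
    using att by (auto simp: attractor_def)
  then have q_eq: "q = \<mu> *\<^sub>R p"
    using vfield_on_S3[of p q] by (simp add: \<mu>_def)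
  with q have \<mu>: "\<mu> \<noteq> 0" by auto
  obtain x where x: "x \<noteq> 0" "orthogonal q x"
    using orthogonal_to_vector_exists[of q] by (auto simp: DIM_prod)
  let ?x = "sgn x"
  have x_S3: "?x \<in> S3" and xq: "inner ?x q = 0"
    using x by (auto simp: norm_sgn orthogonal_def sgn_div_norm inner_commute)
  obtain s where s: "s 0 = 0" and "continuous_on UNIV s"
    and bound: "\<And>t. 0 \<le> t \<Longrightarrow> (norm q + inner ?x q) / (2 * norm q) * t \<le> s t"
    and curve: "\<And>I. integral_curve (vfield q) (\<lambda>t. sgn (?x + s t *\<^sub>R q)) I"
    using integral_curve_through[OF x_S3 q] by blast
  have "?x \<noteq> - p"
    using xq \<mu> by (auto simp: \<mu>_def inner_commute)
  then have "((\<lambda>t. sgn (?x + s t *\<^sub>R q)) \<longlongrightarrow> p) at_top"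
    by (intro lim curve) (use x_S3 in \<open>simp add: s sgn_div_norm[of ?x]\<close>)
  then have "((\<lambda>t. inner q (sgn (?x + s t *\<^sub>R q))) \<longlongrightarrow> \<mu>) at_top"
    unfolding \<mu>_def by (intro tendsto_intros)
  moreover have "\<forall>\<^sub>F t in at_top. 0 \<le> inner q (sgn (?x + s t *\<^sub>R q))"
    using eventually_ge_at_top[of 0]
  proof eventually_elim
    case (elim t)
    have "0 \<le> (norm q + inner ?x q) / (2 * norm q) * t"
      using elim xq by simp
    then have "0 \<le> s t" using bound[OF elim] by linarith
    moreover have "inner q (?x + s t *\<^sub>R q) = s t * inner q q"
      using xq by (simp add: inner_add_right inner_commute[of q ?x])
    ultimately show ?case
      unfolding sgn_div_norm[of "?x + s t *\<^sub>R q"] by simp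
  qed
  ultimately have "0 \<le> \<mu>"
    by (rule tendsto_lowerbound) simp
  with \<mu> have "sgn q = sgn p"
    using arg_cong[OF q_eq, of sgn] by (simp add: sgn_scaleR)
  also have "\<dots> = p" using p by (simp add: sgn_div_norm)
  finally show ?thesis by simp
qed

lemma great_circle_through_two_points:
  assumes "u \<in> S3" "v \<in> S3"
  shows "\<exists>K. great_circle K \<and> u \<in> K \<and> v \<in> K"
proof -
  have u: "u \<noteq> 0" using assms by auto
  obtain b where b: "b \<notin> span {u}" "v \<in> span {u, b}"
  proof (cases "v \<in> span {u}")
    case True
    obtain x where x: "x \<noteq> 0" "orthogonal u x"
      using orthogonal_to_vector_exists[of u] by (auto simp: DIM_prod)
    have "x \<notin> span {u}"
      using x u by (auto simp: span_singleton orthogonal_def)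
    moreover have "v \<in> span {u, x}"
      using True span_mono[of "{u}" "{u, x}"] by auto
    ultimately show ?thesis by (rule that)
  next
    case False
    then show ?thesis by (intro that[of v]) (auto intro: span_base)
  qed
  have "independent {b, u}"
    using b(1) u by (intro independent_insertI) (auto simp: independent_empty)
  moreover have "b \<noteq> u" using b(1) by (auto intro: span_base)
  ultimately have "dim (span {u, b}) = 2"
    by (simp add: dim_span insert_commute dim_eq_card_independent)
  moreover have "u \<in> span {u, b}" by (simp add: span_base)
  ultimately show ?thesis
    using assms b(2) unfolding great_circle_def
    by (intro exI[of _ "span {u, b} \<inter> S3"]) (auto intro!: exI[of _ "span {u, b}"] subspace_span)
qed

theorem theorem5p3:
  fixes z\<^sub>1 z\<^sub>2 p\<^sub>1 p\<^sub>2 :: quat and \<Gamma> :: "(quat \<Rightarrow> quat) set"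
  assumes "z\<^sub>1 \<in> ImH" and "z\<^sub>2 \<in> ImH"
    and "\<Gamma> = {vfield qone, vfield (qone + z\<^sub>1), vfield (qone + z\<^sub>2)}"
    and "attractor (vfield (qone + z\<^sub>1)) p\<^sub>1"
    and "attractor (vfield (qone + z\<^sub>2)) p\<^sub>2"
    and "\<not> (\<exists>K. great_circle K \<and> qone \<in> K \<and> p\<^sub>1 \<in> K \<and> p\<^sub>2 \<in> K)"
  shows "\<forall>C. invariant_control_set \<Gamma> C \<longleftrightarrow> C = spherical_closed_convex_hull {qone, p\<^sub>1, p\<^sub>2}"
proof
  fix C
  let ?Q = "{qone, qone + z\<^sub>1, qone + z\<^sub>2}"
  have pos: "0 < inner qone q" if "q \<in> ?Q" for q
    using that assms(1,2) by (auto simp: qone_def ImH_def inner_prod_def)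
  have one: "sgn qone = qone" "qone \<in> S3"
    by (simp_all add: qone_def sgn_div_norm norm_prod_def)
  have p1: "p\<^sub>1 = sgn (qone + z\<^sub>1)"
    using pos[of "qone + z\<^sub>1"] by (intro attractor_eq_sgn assms) auto
  have p2: "p\<^sub>2 = sgn (qone + z\<^sub>2)"
    using pos[of "qone + z\<^sub>2"] by (intro attractor_eq_sgn assms) auto
  have "qone \<noteq> p\<^sub>1"
    using great_circle_through_two_points[of qone p\<^sub>2] one(2) assms(5,6)
    unfolding attractor_def by metis
  then have "sgn qone \<noteq> sgn (qone + z\<^sub>1)"
    by (simp add: p1 one)
  then have "invariant_control_set (vfield ` ?Q) C \<longleftrightarrow> C = spherical_closed_convex_hull ?Q"
    using invariant_control_set_iff_hull[where Q = ?Q and e = qone, OF pos] by blast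
  moreover have "sgn ` ?Q = {qone, p\<^sub>1, p\<^sub>2}"
    by (simp add: p1 p2 one)
  then have "spherical_closed_convex_hull {qone, p\<^sub>1, p\<^sub>2} = spherical_closed_convex_hull ?Q"
    unfolding spherical_closed_convex_hull_def using co_sgn_image[of ?Q] by simp
  ultimately show "invariant_control_set \<Gamma> C \<longleftrightarrow> C = spherical_closed_convex_hull {qone, p\<^sub>1, p\<^sub>2}"
    using assms(3) by simp
qed

end
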